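(* Let $X$ be a real Banach space with $\dim(X)\ge 2$ and suppose that the following conditions hold: (1) $\mathrm{NA}(S_{X^*})\subset S_{X^*}$ is comeager. (2) $X^*$ is weakly Asplund. Then there does not exist a G-smooth point $x\in S_X$ which is $\omega$-isolated in $\omega\text{-}\mathrm{exp}(B_X)$. Moreover, if $X$ additionally satisfies condition $(\ast)$, then $\omega\text{-}\mathrm{exp}(B_X)\subset S_X$ is dense.
   Context: For a real Banach space $X$, $B_X$ is the closed unit ball and $S_X$ the unit sphere; spheres carry the norm topology unless stated otherwise. The duality mapping is $J(x)=\{x^*\in S_{X^*}\mid x^*(x)=1\}$ for $x\in S_X$, and $J(A)=\bigcup_{a\in A}J(a)$ for $A\subset S_X$. $\mathrm{NA}(S_{X^*})=J(S_X)$ is the set of norm-attaining functionals in $S_{X^*}$. A subset $A$ of a topological space $T$ is comeager if it contains a countable intersection of open dense subsets of $T$. A point $y\in S_Y$ of a Banach space $Y$ is G-smooth if the norm of $Y$ is Gâteaux differentiable at $y$ (equivalently there is a unique $\psi\in S_{Y^*}$ with $\psi(y)=1$). A Banach space $Y$ is called weakly Asplund if the set of G-smooth points of $S_Y$ is a dense $G_\delta$-set in $S_Y$. A point $x\in S_X$ is $\omega$-exposed if there is $f\in S_{X^*}$ such that whenever $(x_n)\subset B_X$ is a sequence with $\lim_{n\to\infty}f(x_n)=1$ then $x_n\to x$ in the weak topology of $X$; $\omega\text{-}\mathrm{exp}(B_X)$ denotes the set of $\omega$-exposed points. A point $x$ is $\omega$-isolated in $\omega\text{-}\mathrm{exp}(B_X)$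 if $x\in\omega\text{-}\mathrm{exp}(B_X)$ and $x$ is an isolated point of $\omega\text{-}\mathrm{exp}(B_X)$ in the relative weak topology. Condition $(\ast)$ for $X$: for each relatively open non-empty $U\subset S_X$ the set $J(U)$ contains an interior point relative to $\mathrm{NA}(S_{X^*})$; equivalently, for each dense subset $A$ of $\mathrm{NA}(S_{X^*})$ the set $\{x\in S_X\mid J(x)\cap A\ne\emptyset\}$ is dense in $S_X$. *)

theory Defs
  imports "HOL-Analysis.Analysis"
begin

definition duality_map :: "'a::real_normed_vector \<Rightarrow> ('a \<Rightarrow>\<^sub>L real) set"
  where "duality_map x = {f \<in> sphere 0 1. blinfun_apply f x = 1}"

definition duality_image :: "'a::real_normed_vector set \<Rightarrow> ('a \<Rightarrow>\<^sub>L real) set"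
  where "duality_image A = (\<Union>a\<in>A. duality_map a)"

definition norm_attaining :: "('a::real_normed_vector \<Rightarrow>\<^sub>L real) set"
  where "norm_attaining = duality_image (sphere 0 1)"

definition dense_in :: "'a topology \<Rightarrow> 'a set \<Rightarrow> bool"
  where "dense_in T A \<longleftrightarrow> A \<subseteq> topspace T \<and> T closure_of A = topspace T"

(* The intersection is taken inside the space, so the empty family gives topspace T. *)
definition comeager_in :: "'a topology \<Rightarrow> 'a set \<Rightarrow> bool"
  where "comeager_in T A \<longleftrightarrow> A \<subseteq> topspace T \<and>
    (\<exists>\<U>. countable \<U> \<and> (\<forall>U\<in>\<U>. openin T U \<and> dense_in T U) \<and> topspace T \<inter> \<Inter>\<U> \<subseteq> A)"

definition Gateaux_differentiable ::
    "('a::real_normed_vector \<Rightarrow> 'b::real_normed_vector) \<Rightarrow> 'a \<Rightarrow> bool"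
  where "Gateaux_differentiable F x \<longleftrightarrow>
    (\<exists>L :: 'a \<Rightarrow>\<^sub>L 'b. \<forall>h.
       ((\<lambda>t. (F (x + t *\<^sub>R h) - F x) /\<^sub>R t) \<longlongrightarrow> blinfun_apply L h) (at (0::real)))"

definition G_smooth :: "'a::real_normed_vector \<Rightarrow> bool"
  where "G_smooth x \<longleftrightarrow> x \<in> sphere 0 1 \<and> Gateaux_differentiable norm x"

definition weakly_Asplund :: "'a::banach itself \<Rightarrow> bool"
  where "weakly_Asplund TYPE('a) \<longleftrightarrow>
    gdelta_in (top_of_set (sphere 0 1)) {y::'a. G_smooth y} \<and>
    dense_in (top_of_set (sphere 0 1)) {y::'a. G_smooth y}"

definition weak_topology :: "'a::real_normed_vector topology"
  where "weak_topology =
    topology_generated_by {blinfun_apply f -` U | (f :: 'a \<Rightarrow>\<^sub>L real) U. open U}"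

definition omega_exp :: "'a::real_normed_vector set"
  where "omega_exp = {x \<in> sphere 0 1. \<exists>f \<in> sphere (0 :: 'a \<Rightarrow>\<^sub>L real) 1.
    \<forall>\<sigma> :: nat \<Rightarrow> 'a. range \<sigma> \<subseteq> cball 0 1 \<and> (\<lambda>n. blinfun_apply f (\<sigma> n)) \<longlonglongrightarrow> 1
      \<longrightarrow> limitin weak_topology \<sigma> x sequentially}"

definition omega_isolated :: "'a::real_normed_vector \<Rightarrow> bool"
  where "omega_isolated x \<longleftrightarrow>
    x \<in> omega_exp \<and> openin (subtopology weak_topology omega_exp) {x}"

definition condition_star :: "'a::real_normed_vector itself \<Rightarrow> bool"
  where "condition_star TYPE('a) \<longleftrightarrow>
    (\<forall>U :: 'a set. openin (top_of_set (sphere 0 1)) U \<and> U \<noteq> {} \<longrightarrow>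
       top_of_set norm_attaining interior_of duality_image U \<noteq> {})"

(* Unlike dim, which is 0 on infinite-dimensional spaces, this also covers infinite dimension. *)
definition dim_at_least :: "'a::real_vector itself \<Rightarrow> nat \<Rightarrow> bool"
  where "dim_at_least TYPE('a) n \<longleftrightarrow> (\<exists>B :: 'a set. finite B \<and> card B = n \<and> independent B)"

end

theory Submission
  imports Defs
begin

text \<open>
  By Baire's theorem the G-smooth norm-attaining functionals are dense in the dual sphere. If such
  a functional f attains its norm at y, then the difference quotients of the dual norm at f force
  every sequence of the unit ball that is maximising for f to converge weakly to y
  (Smulian's argument), so y is an \<open>\<omega>\<close>-exposed point. Together with condition \<open>(\<ast>)\<close> this gives the
  density of the \<open>\<omega>\<close>-exposed points. If x is G-smooth, exposed by f and isolated by a weak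
  neighbourhood V, then V contains a slice of the ball determined by f; a G-smooth norm-attaining
  functional g close to f attains its norm inside that slice, hence at x, and so g = f because the
  norm is smooth at x. Thus f would be an isolated point of the dual sphere, which is impossible
  when the dual has dimension at least two.
\<close>

section \<open>Functionals separating points\<close>

text \<open>Only the inequality for positive factors is demanded, which is easier to check for
  infima; \<open>sublinear_scale\<close> recovers equality, also for the factor 0.\<close>

definition sublinear :: "('a::real_vector \<Rightarrow> real) \<Rightarrow> bool"
  where "sublinear p \<longleftrightarrow>
    (\<forall>x y. p (x + y) \<le> p x + p y) \<and> (\<forall>c>0. \<forall>x. p (c *\<^sub>R x) \<le> c * p x)"

lemma sublinear_add: "sublinear p \<Longrightarrow> p (x + y) \<le> p x + p y"
  by (simp add: sublinear_def)

lemma sublinear_scale_le: "sublinear p \<Longrightarrow> c > 0 \<Longrightarrow> p (c *\<^sub>R x) \<le> c * p x"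
  by (simp add: sublinear_def)

lemma sublinear_0:
  assumes "sublinear p" shows "p 0 = 0"
  using sublinear_scale_le[OF assms, of 2 0] sublinear_scale_le[OF assms, of "1/2" 0] by simp

lemma sublinear_scale:
  assumes p: "sublinear p" and "c \<ge> 0" shows "p (c *\<^sub>R x) = c * p x"
proof (cases "c = 0")
  case True
  then show ?thesis using sublinear_0[OF p] by simp
next
  case False
  with assms have c: "c > 0" by simp
  have "p x \<le> inverse c * p (c *\<^sub>R x)"
    using sublinear_scale_le[OF p, of "inverse c" "c *\<^sub>R x"] c by simp
  then have "c * p x \<le> p (c *\<^sub>R x)" using c by (simp add: field_simps)
  with sublinear_scale_le[OF p c, of x] show ?thesis by simp
qed

lemma sublinear_ge: "sublinear p \<Longrightarrow> - p (- x) \<le> p x"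
  using sublinear_add[of p x "- x"] sublinear_0[of p] by simp

lemma sublinear_norm: "sublinear norm"
  by (simp add: sublinear_def norm_triangle_ineq)

section \<open>Infima of sublinear functionals\<close>

lemma le_cINF_add_cINF:
  fixes f :: "'i \<Rightarrow> real" and g :: "'j \<Rightarrow> real"
  assumes "A \<noteq> {}" "B \<noteq> {}" and le: "\<And>a b. a \<in> A \<Longrightarrow> b \<in> B \<Longrightarrow> z \<le> f a + g b"
  shows "z \<le> (INF a\<in>A. f a) + (INF b\<in>B. g b)"
proof -
  have "z - (INF b\<in>B. g b) \<le> f a" if "a \<in> A" for a
  proof -
    have "z - f a \<le> (INF b\<in>B. g b)"
      using assms(2) le[OF that] by (intro cINF_greatest) (auto simp: algebra_simps)
    then show ?thesis by simp
  qed
  then have "z - (INF b\<in>B. g b) \<le> (INF a\<in>A. f a)"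
    by (rule cINF_greatest[OF assms(1)])
  then show ?thesis by simp
qed

lemma le_mult_cINF:
  fixes f :: "'i \<Rightarrow> real"
  assumes "A \<noteq> {}" "c > 0" and le: "\<And>a. a \<in> A \<Longrightarrow> z \<le> c * f a"
  shows "z \<le> c * (INF a\<in>A. f a)"
proof -
  have "z / c \<le> (INF a\<in>A. f a)"
    using assms by (intro cINF_greatest) (auto simp: field_simps)
  then show ?thesis using assms(2) by (simp add: field_simps)
qed

text \<open>The largest sublinear functional \<open>q \<le> p\<close> with \<open>q (- y) \<le> - p y\<close>.\<close>

definition sublinear_descent :: "('a::real_vector \<Rightarrow> real) \<Rightarrow> 'a \<Rightarrow> 'a \<Rightarrow> real"
  where "sublinear_descent p y x = (INF t\<in>{0..}. p (x + t *\<^sub>R y) - t * p y)"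

text \<open>A real infimum is a lower bound only for a family bounded below; here
  \<open>- p (- x)\<close> is such a bound, by subadditivity applied to the sum of
  \<open>x + t y\<close> and \<open>- x\<close>.\<close>

lemma sublinear_descent_le:
  assumes p: "sublinear p" and "t \<ge> 0"
  shows "sublinear_descent p y x \<le> p (x + t *\<^sub>R y) - t * p y"
proof -
  have "bdd_below ((\<lambda>t. p (x + t *\<^sub>R y) - t * p y) ` {0..})"
  proof (rule bdd_belowI2)
    fix t :: real assume "t \<in> {0..}"
    then show "- p (- x) \<le> p (x + t *\<^sub>R y) - t * p y"
      using sublinear_add[OF p, of "x + t *\<^sub>R y" "- x"] sublinear_scale[OF p, of t y] by simp
  qed
  then show ?thesis
    unfolding sublinear_descent_def using assms(2) by (intro cINF_lower) auto
qed

lemma sublinear_sublinear_descent: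
  assumes p: "sublinear p" shows "sublinear (sublinear_descent p y)"
  unfolding sublinear_def
proof (intro conjI allI impI)
  fix u v
  show "sublinear_descent p y (u + v) \<le> sublinear_descent p y u + sublinear_descent p y v"
    unfolding sublinear_descent_def[of p y u] sublinear_descent_def[of p y v]
  proof (rule le_cINF_add_cINF)
    fix s t :: real assume "s \<in> {0..}" "t \<in> {0..}"
    \<comment> \<open>The parameters \<open>s\<close> for \<open>u\<close> and \<open>t\<close> for
      \<open>v\<close> combine to the parameter \<open>s + t\<close> for
      \<open>u + v\<close>.\<close>
    then have "sublinear_descent p y (u + v) \<le> p ((u + v) + (s + t) *\<^sub>R y) - (s + t) * p y"
      by (intro sublinear_descent_le[OF p]) simp
    also have "(u + v) + (s + t) *\<^sub>R y = (u + s *\<^sub>R y) + (v + t *\<^sub>R y)"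
      by (simp add: algebra_simps)
    also have "p \<dots> - (s + t) * p y
        \<le> (p (u + s *\<^sub>R y) - s * p y) + (p (v + t *\<^sub>R y) - t * p y)"
      using sublinear_add[OF p, of "u + s *\<^sub>R y" "v + t *\<^sub>R y"] by (simp add: algebra_simps)
    finally show "sublinear_descent p y (u + v)
        \<le> (p (u + s *\<^sub>R y) - s * p y) + (p (v + t *\<^sub>R y) - t * p y)" .
  qed auto
next
  fix c :: real and x assume c: "c > 0"
  show "sublinear_descent p y (c *\<^sub>R x) \<le> c * sublinear_descent p y x"
    unfolding sublinear_descent_def[of p y x]
  proof (rule le_mult_cINF)
    fix t :: real assume "t \<in> {0..}"
    then have "sublinear_descent p y (c *\<^sub>R x) \<le> p (c *\<^sub>R x + (c * t) *\<^sub>R y) - (c * t) * p y"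
      using c by (intro sublinear_descent_le[OF p]) simp
    also have "c *\<^sub>R x + (c * t) *\<^sub>R y = c *\<^sub>R (x + t *\<^sub>R y)"
      by (simp add: algebra_simps)
    also have "p \<dots> = c * p (x + t *\<^sub>R y)"
      using c by (simp add: sublinear_scale[OF p])
    finally show "sublinear_descent p y (c *\<^sub>R x) \<le> c * (p (x + t *\<^sub>R y) - t * p y)"
      by (simp add: algebra_simps)
  qed (use c in auto)
qed

text \<open>Zorn's lemma for the reversed pointwise order: the pointwise infimum of a nonempty chain
  is again sublinear and bounds the chain from below.\<close>

lemma exists_minimal_sublinear:
  fixes p0 :: "'a::real_vector \<Rightarrow> real"
  assumes p0: "sublinear p0"
  obtains m where "sublinear m" "m \<le> p0" "\<And>q. sublinear q \<Longrightarrow> q \<le> m \<Longrightarrow> q = m"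
proof -
  let ?A = "{p. sublinear p \<and> p \<le> p0}"
  let ?r = "relation_of (\<lambda>p q. q \<le> p) ?A"
  have "\<exists>m\<in>?A. \<forall>q\<in>?A. q \<le> m \<longrightarrow> q = m"
  proof (rule predicate_Zorn)
    show "partial_order_on ?A ?r"
      by (rule partial_order_on_relation_ofI) auto
  next
    fix C assume C: "C \<in> Chains ?r"
    show "\<exists>u\<in>?A. \<forall>p\<in>C. u \<le> p"
    proof (cases "C = {}")
      case True
      then show ?thesis using p0 by auto
    next
      case False
      have CA: "C \<subseteq> ?A" and total: "p \<le> q \<or> q \<le> p" if "p \<in> C" "q \<in> C" for p q
        using C that unfolding Chains_def relation_of_def by blast+
      have CA: "sublinear p" "p \<le> p0" if "p \<in> C" for p
        using CA[OF that that] that by auto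
      define u where "u x = (INF p\<in>C. p x)" for x
      have u_le: "u x \<le> p x" if "p \<in> C" for p x
      proof -
        \<comment> \<open>The chain \<open>- p0 (- x) \<le> - q (- x) \<le> q x\<close> gives a
          bound independent of \<open>q\<close>.\<close>
        have "- p0 (- x) \<le> q x" if "q \<in> C" for q
          using sublinear_ge[OF CA(1)[OF that], of x] CA(2)[OF that]
          by (smt (verit) le_fun_def)
        then have "bdd_below ((\<lambda>p. p x) ` C)" by (rule bdd_belowI2)
        then show ?thesis unfolding u_def using that by (rule cINF_lower)
      qed
      have "sublinear u"
        unfolding sublinear_def
      proof (intro conjI allI impI)
        fix x y
        show "u (x + y) \<le> u x + u y"
          unfolding u_def[of x] u_def[of y]
        proof (rule le_cINF_add_cINF[OF False False])
          fix p q assume pq: "p \<in> C" "q \<in> C"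
          \<comment> \<open>The smaller of \<open>p\<close> and \<open>q\<close> gives
            \<open>u (x + y) \<le> r (x + y) \<le> r x + r y \<le> p x + q y\<close>.\<close>
          from total[OF pq] obtain r where "r \<in> C" "r \<le> p" "r \<le> q"
            using pq by blast
          then show "u (x + y) \<le> p x + q y"
            using u_le[of r "x + y"] sublinear_add[OF CA(1), of r x y]
            by (smt (verit) le_fun_def)
        qed
      next
        fix c :: real and x assume c: "c > 0"
        show "u (c *\<^sub>R x) \<le> c * u x"
          unfolding u_def[of x]
        proof (rule le_mult_cINF[OF False c])
          fix p assume "p \<in> C"
          then show "u (c *\<^sub>R x) \<le> c * p x"
            using u_le sublinear_scale_le[OF CA(1) c] by (meson order_trans)
        qed
      qed
      moreover have "u \<le> p" if "p \<in> C" for p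
        using u_le[OF that] by (simp add: le_fun_def)
      moreover have "u \<le> p0"
        using False CA(2) calculation(2) by (meson ex_in_conv order_trans)
      ultimately show ?thesis by blast
    qed
  qed
  then obtain m where m: "sublinear m" "m \<le> p0"
    and min: "\<And>q. sublinear q \<Longrightarrow> q \<le> p0 \<Longrightarrow> q \<le> m \<Longrightarrow> q = m" by blast
  show ?thesis
    by (rule that[OF m min]) (use m(2) order_trans in blast)+
qed

text \<open>Minimality makes every \<open>sublinear_descent m y\<close> equal to \<open>m\<close>;
  its bound at \<open>t = 1\<close> is superadditivity, so \<open>m\<close> is additive.\<close>

lemma minimal_sublinear_imp_linear:
  assumes m: "sublinear m" and min: "\<And>q. sublinear q \<Longrightarrow> q \<le> m \<Longrightarrow> q = m"
  shows "linear m"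
proof -
  have "sublinear_descent m y = m" for y
  proof (rule min[OF sublinear_sublinear_descent[OF m]])
    show "sublinear_descent m y \<le> m"
      using sublinear_descent_le[OF m, of 0 y] by (simp add: le_fun_def)
  qed
  then have "m x \<le> m (x + y) - m y" for x y
    using sublinear_descent_le[OF m, of 1 y x] by simp
  then have add: "m (x + y) = m x + m y" for x y
    using sublinear_add[OF m, of x y] by (smt (verit))
  have neg: "m (- x) = - m x" for x
    using add[of x "- x"] sublinear_0[OF m] by simp
  show ?thesis
  proof (rule linearI)
    fix c :: real and x
    show "m (c *\<^sub>R x) = c *\<^sub>R m x"
      using sublinear_scale[OF m, of c x] sublinear_scale[OF m, of "- c" x] neg[of "c *\<^sub>R x"]
      by (cases "c \<ge> 0") auto
  qed (rule add)
qed

text \<open>A form of Hahn-Banach: descending from the norm along \<open>z\<close> before minimising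
  forces \<open>m (- z) \<le> - norm z\<close>, hence \<open>m z \<ge> norm z > 0\<close>.\<close>

lemma exists_functional_nonzero:
  fixes z :: "'a::real_normed_vector"
  assumes "z \<noteq> 0"
  obtains h :: "'a \<Rightarrow>\<^sub>L real" where "h z \<noteq> 0"
proof -
  let ?q = "sublinear_descent norm z"
  obtain m where m: "sublinear m" "m \<le> ?q" "\<And>q. sublinear q \<Longrightarrow> q \<le> m \<Longrightarrow> q = m"
    using exists_minimal_sublinear[OF sublinear_sublinear_descent[OF sublinear_norm]] by metis
  have lin: "linear m"
    using minimal_sublinear_imp_linear m by blast
  \<comment> \<open>The parameter 0 of the descent gives continuity; below, the parameter 1 at
    \<open>- z\<close> gives the strict sign, since \<open>norm (- z + z) = 0\<close>.\<close>
  have le: "m x \<le> norm x" for x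
    using m(2) sublinear_descent_le[OF sublinear_norm, of 0 z x]
    by (simp add: le_fun_def) (meson order_trans)
  have "bounded_linear m"
  proof (rule bounded_linear_intro[where K = 1])
    fix x y show "m (x + y) = m x + m y" by (rule linear_add[OF lin])
  next
    fix c x show "m (c *\<^sub>R x) = c *\<^sub>R m x" by (rule linear_scale[OF lin])
  next
    fix x show "norm (m x) \<le> norm x * 1"
      using le[of x] le[of "- x"] linear_neg[OF lin, of x] by (simp add: abs_le_iff)
  qed
  then have "blinfun_apply (Blinfun m) z = m z" by (simp add: bounded_linear_Blinfun_apply)
  moreover have "m (- z) \<le> - norm z"
    using m(2) sublinear_descent_le[OF sublinear_norm, of 1 z "- z"]
    by (simp add: le_fun_def) (meson order_trans)
  then have "m z \<noteq> 0" using linear_neg[OF lin, of z] assms by auto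
  ultimately show ?thesis using that by metis
qed

section \<open>The dual sphere has no isolated points\<close>

lemma dim_at_least_2_exists_kernel:
  fixes f :: "'a::real_normed_vector \<Rightarrow>\<^sub>L real"
  assumes "dim_at_least TYPE('a) 2"
  obtains z where "z \<noteq> 0" "f z = 0"
proof -
  obtain a b :: 'a where ab: "a \<noteq> b" and ind: "independent {a, b}"
    using assms unfolding dim_at_least_def by (metis card_2_iff)
  have a: "a \<noteq> 0"
    using ind dependent_zero[of "{a, b}"] by auto
  have "independent {b, a}" using ind by (simp add: insert_commute)
  then have b: "b \<notin> span {a}"
    using ab by (simp add: independent_insert)
  show ?thesis
  proof (cases "f a = 0")
    case True
    with a show ?thesis by (rule that)
  next
    case False
    show ?thesis
    proof (rule that)
      \<comment> \<open>Subtracting the multiple of \<open>a\<close> with the same value under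
        \<open>f\<close> moves \<open>b\<close> into the kernel; the result is nonzero because
        \<open>b\<close> is outside the span of \<open>a\<close>.\<close>
      show "b - (f b / f a) *\<^sub>R a \<noteq> 0"
        using b span_base[of a "{a}"] span_scale[of a "{a}" "f b / f a"] by auto
      show "f (b - (f b / f a) *\<^sub>R a) = 0"
        using False by (simp add: blinfun.diff_right blinfun.scaleR_right)
    qed
  qed
qed

text \<open>\<open>f\<close> is perturbed along a functional \<open>h\<close> with
  \<open>h z \<noteq> 0\<close> at a kernel vector \<open>z\<close> of \<open>f\<close>, then
  renormalised; for \<open>t \<noteq> 0\<close> the value at \<open>z\<close> separates the result
  from \<open>f\<close>.\<close>

lemma exists_near_on_dual_sphere:
  fixes f :: "'a::real_normed_vector \<Rightarrow>\<^sub>L real"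
  assumes dim: "dim_at_least TYPE('a) 2" and f: "norm f = 1" and "e > 0"
  obtains g where "norm g = 1" "g \<noteq> f" "dist g f < e"
proof -
  obtain z where z: "z \<noteq> 0" "f z = 0" using dim_at_least_2_exists_kernel[OF dim] .
  obtain h :: "'a \<Rightarrow>\<^sub>L real" where h: "h z \<noteq> 0" using exists_functional_nonzero[OF z(1)] .
  have nz: "f + t *\<^sub>R h \<noteq> 0" for t
  proof
    assume 0: "f + t *\<^sub>R h = 0"
    then have "blinfun_apply (f + t *\<^sub>R h) z = 0" by simp
    then have "t = 0" using z h by (simp add: blinfun.add_left blinfun.scaleR_left)
    with 0 f show False by simp
  qed
  have "((\<lambda>t. (f + t *\<^sub>R h) /\<^sub>R norm (f + t *\<^sub>R h)) \<longlongrightarrow> (f + 0 *\<^sub>R h) /\<^sub>R norm (f + 0 *\<^sub>R h)) (at 0)"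
    using nz[of 0] by (intro tendsto_intros) auto
  then have "((\<lambda>t. (f + t *\<^sub>R h) /\<^sub>R norm (f + t *\<^sub>R h)) \<longlongrightarrow> f) (at 0)"
    using f by simp
  then have "eventually (\<lambda>t. dist ((f + t *\<^sub>R h) /\<^sub>R norm (f + t *\<^sub>R h)) f < e) (at 0)"
    using \<open>e > 0\<close> by (rule tendstoD)
  moreover have "eventually (\<lambda>t::real. t \<noteq> 0) (at 0)"
    by (simp add: eventually_at_filter)
  ultimately have "\<forall>\<^sub>F t in at 0. dist ((f + t *\<^sub>R h) /\<^sub>R norm (f + t *\<^sub>R h)) f < e \<and> t \<noteq> 0"
    by (rule eventually_conj)
  then obtain t :: real
    where t: "dist ((f + t *\<^sub>R h) /\<^sub>R norm (f + t *\<^sub>R h)) f < e" "t \<noteq> 0"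
    using eventually_happens'[OF trivial_limit_at] by blast
  show ?thesis
  proof (rule that)
    let ?g = "(f + t *\<^sub>R h) /\<^sub>R norm (f + t *\<^sub>R h)"
    show "norm ?g = 1" using nz[of t] by simp
    show "dist ?g f < e" by (rule t)
    have "blinfun_apply ?g z \<noteq> 0"
      using nz[of t] h z t by (simp add: blinfun.add_left blinfun.scaleR_left)
    then show "?g \<noteq> f" using z by metis
  qed
qed

section \<open>Weak convergence and exposed points\<close>

lemma topspace_weak_topology [simp]: "topspace weak_topology = UNIV"
  unfolding weak_topology_def topology_generated_by_topspace by (auto intro!: exI[of _ UNIV])

lemma limitin_weak_topology_iff:
  fixes \<sigma> :: "nat \<Rightarrow> 'a::real_normed_vector"
  shows "limitin weak_topology \<sigma> x sequentially \<longleftrightarrow>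
    (\<forall>h :: 'a \<Rightarrow>\<^sub>L real. (\<lambda>n. h (\<sigma> n)) \<longlonglongrightarrow> h x)"
proof (intro iffI allI)
  fix h :: "'a \<Rightarrow>\<^sub>L real"
  assume lim: "limitin weak_topology \<sigma> x sequentially"
  show "(\<lambda>n. h (\<sigma> n)) \<longlonglongrightarrow> h x"
  proof (rule topological_tendstoI)
    fix U :: "real set" assume U: "open U" "h x \<in> U"
    have "openin weak_topology (blinfun_apply h -` U)"
      unfolding weak_topology_def by (rule topology_generated_by_Basis) (use U in blast)
    then show "\<forall>\<^sub>F n in sequentially. h (\<sigma> n) \<in> U"
      using lim U unfolding limitin_def by auto
  qed
next
  assume lim: "\<forall>h :: 'a \<Rightarrow>\<^sub>L real. (\<lambda>n. h (\<sigma> n)) \<longlonglongrightarrow> h x"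
  have "\<forall>\<^sub>F n in sequentially. \<sigma> n \<in> V" if "openin weak_topology V" "x \<in> V" for V
  proof -
    \<comment> \<open>Eventual membership holds for subbasic sets by hypothesis and survives binary
      intersections and arbitrary unions, so induction on the generation of \<open>V\<close>
      applies.\<close>
    have "generate_topology_on {blinfun_apply f -` U | (f :: 'a \<Rightarrow>\<^sub>L real) U. open U} V"
      using that(1) unfolding weak_topology_def by (rule openin_topology_generated_by)
    then show ?thesis using that(2)
    proof induction
      case (Int A B)
      then show ?case by (auto intro: eventually_conj)
    next
      case (UN K)
      then obtain A where "A \<in> K" "x \<in> A" by blast
      with UN have "\<forall>\<^sub>F n in sequentially. \<sigma> n \<in> A" by blast
      then show ?case by eventually_elim (use \<open>A \<in> K\<close> in blast)
    next
      case (Basis S)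
      then obtain f :: "'a \<Rightarrow>\<^sub>L real" and U where "open U" "S = blinfun_apply f -` U" by blast
      with Basis lim show ?case by (auto dest: topological_tendstoD)
    qed auto
  qed
  then show "limitin weak_topology \<sigma> x sequentially" by (simp add: limitin_def)
qed

section \<open>Exposing functionals and slices\<close>

definition omega_exposes :: "('a::real_normed_vector \<Rightarrow>\<^sub>L real) \<Rightarrow> 'a \<Rightarrow> bool"
  where "omega_exposes f x \<longleftrightarrow>
    (\<forall>\<sigma> :: nat \<Rightarrow> 'a. range \<sigma> \<subseteq> cball 0 1 \<and> (\<lambda>n. f (\<sigma> n)) \<longlonglongrightarrow> 1
      \<longrightarrow> limitin weak_topology \<sigma> x sequentially)"

lemma omega_exp_iff:
  "x \<in> omega_exp \<longleftrightarrow> norm x = 1 \<and> (\<exists>f. norm f = 1 \<and> omega_exposes f x)"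
  by (simp add: omega_exp_def omega_exposes_def Bex_def)

lemma blinfun_le_norm: "f x \<le> norm f * norm x" for f :: "'a::real_normed_vector \<Rightarrow>\<^sub>L real"
  using norm_blinfun[of f x] by simp

lemma norm_1_exists_maximizing_sequence:
  fixes f :: "'a::real_normed_vector \<Rightarrow>\<^sub>L real"
  assumes f: "norm f = 1"
  obtains \<sigma> :: "nat \<Rightarrow> 'a" where "range \<sigma> \<subseteq> cball 0 1" "(\<lambda>n. f (\<sigma> n)) \<longlonglongrightarrow> 1"
proof -
  have "\<exists>x. norm x \<le> 1 \<and> f x > 1 - e" if "e > 0" for e
  proof (rule ccontr)
    assume "\<not> ?thesis"
    then have le: "f x \<le> 1 - e" if "norm x \<le> 1" for x using that by force
    \<comment> \<open>By homogeneity a bound on the unit ball bounds the operator norm; the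
      normalised \<open>x\<close> and its negative together control the absolute value.\<close>
    have "norm f \<le> 1 - e"
    proof (rule norm_blinfun_bound)
      show "0 \<le> 1 - e" using le[of 0] by (simp add: blinfun.zero_right)
      fix x
      show "norm (f x) \<le> (1 - e) * norm x"
      proof (cases "x = 0")
        case False
        then show ?thesis
          using le[of "x /\<^sub>R norm x"] le[of "- (x /\<^sub>R norm x)"]
          by (simp add: blinfun.scaleR_right blinfun.minus_right field_simps abs_le_iff)
      qed (simp add: blinfun.zero_right)
    qed
    with f that show False by simp
  qed
  then have "\<exists>x. norm x \<le> 1 \<and> f x > 1 - inverse (real (Suc n))" for n
    by simp
  then obtain \<sigma> where \<sigma>: "\<And>n. norm (\<sigma> n) \<le> 1" "\<And>n. f (\<sigma> n) > 1 - inverse (real (Suc n))"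
    by metis
  have "(\<lambda>n. f (\<sigma> n)) \<longlonglongrightarrow> 1"
  proof (rule real_tendsto_sandwich)
    show "(\<lambda>n. 1 - inverse (real (Suc n))) \<longlonglongrightarrow> 1"
      using tendsto_diff[OF tendsto_const LIMSEQ_inverse_real_of_nat, of "1::real"] by simp
    show "\<forall>\<^sub>F n in sequentially. 1 - inverse (real (Suc n)) \<le> f (\<sigma> n)"
      using \<sigma>(2) by (auto intro: less_imp_le always_eventually)
    show "\<forall>\<^sub>F n in sequentially. f (\<sigma> n) \<le> 1"
      using \<sigma>(1) f by (auto intro!: always_eventually order_trans[OF blinfun_le_norm])
  qed auto
  moreover have "range \<sigma> \<subseteq> cball 0 1" using \<sigma>(1) by auto
  ultimately show ?thesis using that by blast
qed

text \<open>A maximising sequence exists, so the exposing condition is not vacuous: along it the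
  values tend to 1 and, by weak convergence, to \<open>f x\<close>.\<close>

lemma omega_exposes_imp_eq_1:
  assumes f: "norm f = 1" and x: "omega_exposes f x" shows "f x = 1"
proof -
  obtain \<sigma> where \<sigma>: "range \<sigma> \<subseteq> cball 0 1" "(\<lambda>n. f (\<sigma> n)) \<longlonglongrightarrow> 1"
    using norm_1_exists_maximizing_sequence[OF f] .
  then have "limitin weak_topology \<sigma> x sequentially" using x by (simp add: omega_exposes_def)
  then have "(\<lambda>n. f (\<sigma> n)) \<longlonglongrightarrow> f x" by (simp add: limitin_weak_topology_iff)
  with \<sigma>(2) show ?thesis using LIMSEQ_unique by blast
qed

text \<open>If no slice worked, points outside \<open>V\<close> from slices of width
  \<open>1 / (n + 1)\<close> would form a maximising sequence that cannot converge weakly to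
  \<open>x\<close>. The premise \<open>f y \<le> 1\<close> caps the values, since
  \<open>norm f\<close> is not fixed here.\<close>

lemma omega_exposes_imp_slice_subset:
  assumes x: "omega_exposes f x" and V: "openin weak_topology V" "x \<in> V"
  obtains d where "d > 0" "\<And>y. norm y \<le> 1 \<Longrightarrow> f y > 1 - d \<Longrightarrow> f y \<le> 1 \<Longrightarrow> y \<in> V"
proof (rule ccontr)
  assume "\<not> thesis"
  with that have "\<exists>y. norm y \<le> 1 \<and> f y > 1 - d \<and> f y \<le> 1 \<and> y \<notin> V" if "d > 0" for d
    using that by blast
  then have "\<exists>y. norm y \<le> 1 \<and> f y > 1 - inverse (real (Suc n)) \<and> f y \<le> 1 \<and> y \<notin> V" for n
    by simp
  then obtain \<sigma> where \<sigma>: "\<And>n. norm (\<sigma> n) \<le> 1" "\<And>n. f (\<sigma> n) > 1 - inverse (real (Suc n))"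
    "\<And>n. f (\<sigma> n) \<le> 1" "\<And>n. \<sigma> n \<notin> V" by metis
  have "(\<lambda>n. f (\<sigma> n)) \<longlonglongrightarrow> 1"
  proof (rule real_tendsto_sandwich)
    show "(\<lambda>n. 1 - inverse (real (Suc n))) \<longlonglongrightarrow> 1"
      using tendsto_diff[OF tendsto_const LIMSEQ_inverse_real_of_nat, of "1::real"] by simp
    show "\<forall>\<^sub>F n in sequentially. 1 - inverse (real (Suc n)) \<le> f (\<sigma> n)"
      using \<sigma>(2) by (auto intro: less_imp_le always_eventually)
    show "\<forall>\<^sub>F n in sequentially. f (\<sigma> n) \<le> 1"
      using \<sigma>(3) by (auto intro: always_eventually)
  qed auto
  then have "limitin weak_topology \<sigma> x sequentially"
    using x \<sigma>(1) unfolding omega_exposes_def by (auto simp: image_subset_iff)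
  then have "\<forall>\<^sub>F n in sequentially. \<sigma> n \<in> V" using V by (simp add: limitin_def)
  then have "\<forall>\<^sub>F n in sequentially. False" by eventually_elim (use \<sigma>(4) in blast)
  then show False by simp
qed

section \<open>Smoothness\<close>

text \<open>Stated with approximate maximality so that it yields both the uniqueness of the support
  functional (constant sequence) and Smulian's theorem.\<close>

lemma Gateaux_norm_limit:
  fixes y :: "'b::real_normed_vector"
  assumes y: "norm y = 1" and L: "\<And>h. ((\<lambda>t. (norm (y + t *\<^sub>R h) - norm y) /\<^sub>R t) \<longlongrightarrow> L h) (at 0)"
    and lin: "\<And>n. linear (\<phi> n)" and le: "\<And>n h. \<phi> n h \<le> norm h"
    and lim: "(\<lambda>n. \<phi> n y) \<longlonglongrightarrow> (1::real)" and neg: "\<And>h. L (- h) = - L h"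
  shows "(\<lambda>n::nat. \<phi> n h) \<longlonglongrightarrow> L h"
proof -
  \<comment> \<open>For \<open>t > 0\<close>, evaluating \<open>\<phi> n\<close> at
    \<open>y + t h\<close> bounds \<open>\<phi> n h\<close> above by a perturbed difference
    quotient. The lower estimate comes from applying this to \<open>- h\<close>.\<close>
  have upper: "\<forall>\<^sub>F n in sequentially. \<phi> n h < L h + e" if "e > 0" for e h
  proof -
    have "((\<lambda>t. (norm (y + t *\<^sub>R h) - norm y) /\<^sub>R t) \<longlongrightarrow> L h) (at_right 0)"
      using L[of h] by (rule tendsto_within_subset) simp
    then have "\<forall>\<^sub>F t in at_right 0. (norm (y + t *\<^sub>R h) - norm y) /\<^sub>R t < L h + e"
      using that by (intro order_tendstoD) auto
    moreover have "\<forall>\<^sub>F t::real in at_right 0. t > 0"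
      by (simp add: eventually_at_right_less)
    ultimately have "\<forall>\<^sub>F t in at_right 0. (norm (y + t *\<^sub>R h) - norm y) /\<^sub>R t < L h + e \<and> t > 0"
      by (rule eventually_conj)
    then obtain t :: real where t: "(norm (y + t *\<^sub>R h) - norm y) /\<^sub>R t < L h + e" "t > 0"
      using eventually_happens'[OF trivial_limit_at_right_real] by blast
    \<comment> \<open>\<open>t\<close> is fixed before \<open>n\<close> grows, so replacing
      \<open>norm y\<close> by \<open>\<phi> n y\<close> changes the quotient by an error tending to
      0.\<close>
    have "(\<lambda>n. (norm (y + t *\<^sub>R h) - \<phi> n y) /\<^sub>R t) \<longlonglongrightarrow> (norm (y + t *\<^sub>R h) - norm y) /\<^sub>R t"
      using lim y by (intro tendsto_intros) auto
    then have "\<forall>\<^sub>F n in sequentially. (norm (y + t *\<^sub>R h) - \<phi> n y) /\<^sub>R t < L h + e"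
      using t(1) by (rule order_tendstoD)
    then show ?thesis
    proof eventually_elim
      case (elim n)
      have "\<phi> n y + t * \<phi> n h \<le> norm (y + t *\<^sub>R h)"
        using le[of n "y + t *\<^sub>R h"] by (simp add: linear_add[OF lin] linear_scale[OF lin])
      then have "\<phi> n h \<le> (norm (y + t *\<^sub>R h) - \<phi> n y) /\<^sub>R t"
        using t(2) by (simp add: field_simps)
      with elim show ?case by simp
    qed
  qed
  show ?thesis
  proof (rule tendstoI)
    fix e :: real assume e: "e > 0"
    show "\<forall>\<^sub>F n in sequentially. dist (\<phi> n h) (L h) < e"
      using upper[OF e, of h] upper[OF e, of "- h"]
    proof eventually_elim
      case (elim n)
      then show ?case
        by (simp add: neg linear_neg[OF lin] dist_real_def abs_less_iff)
    qed
  qed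
qed

lemma G_smoothE:
  fixes y :: "'b::real_normed_vector"
  assumes "G_smooth y"
  obtains L :: "'b \<Rightarrow>\<^sub>L real" where "norm y = 1"
    "\<And>h. ((\<lambda>t. (norm (y + t *\<^sub>R h) - norm y) /\<^sub>R t) \<longlongrightarrow> L h) (at 0)"
  using assms unfolding G_smooth_def Gateaux_differentiable_def mem_sphere_0 by blast

text \<open>Every support functional at \<open>x\<close> coincides with the Gateaux derivative of
  the norm, as the constant sequence shows.\<close>

lemma G_smooth_unique_support:
  fixes f g :: "'a::real_normed_vector \<Rightarrow>\<^sub>L real"
  assumes x: "G_smooth x" and f: "norm f = 1" "f x = 1" and g: "norm g = 1" "g x = 1"
  shows "f = g"
proof -
  obtain L :: "'a \<Rightarrow>\<^sub>L real" where L: "norm x = 1"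
    "\<And>h. ((\<lambda>t. (norm (x + t *\<^sub>R h) - norm x) /\<^sub>R t) \<longlongrightarrow> L h) (at 0)"
    using G_smoothE[OF x] by blast
  have "k h = L h" if k: "norm k = 1" "k x = 1" for k :: "'a \<Rightarrow>\<^sub>L real" and h
  proof -
    have "(\<lambda>n::nat. k h) \<longlonglongrightarrow> L h"
    proof (rule Gateaux_norm_limit[OF L, where \<phi> = "\<lambda>n. blinfun_apply k"])
      show "linear (blinfun_apply k)"
        by (intro bounded_linear.linear blinfun.bounded_linear_right)
      show "k h \<le> norm h" for h using blinfun_le_norm[of k h] k by simp
    qed (simp_all add: k blinfun.minus_right)
    then show ?thesis by (simp add: LIMSEQ_const_iff)
  qed
  then show ?thesis using f g by (intro blinfun_eqI) simp
qed

text \<open>Smulian's argument: points of the ball act on the dual as evaluations, so smoothness of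
  the dual norm at \<open>f\<close> makes the evaluations along a maximising sequence converge to
  the derivative.\<close>

lemma G_smooth_attaining_imp_omega_exposes:
  fixes f :: "'a::real_normed_vector \<Rightarrow>\<^sub>L real"
  assumes f: "G_smooth f" and x: "norm x = 1" "f x = 1"
  shows "omega_exposes f x"
  unfolding omega_exposes_def
proof (intro allI impI)
  fix \<sigma> :: "nat \<Rightarrow> 'a"
  assume \<sigma>: "range \<sigma> \<subseteq> cball 0 1 \<and> (\<lambda>n. f (\<sigma> n)) \<longlonglongrightarrow> 1"
  obtain L :: "('a \<Rightarrow>\<^sub>L real) \<Rightarrow>\<^sub>L real" where L: "norm f = 1"
    "\<And>h. ((\<lambda>t. (norm (f + t *\<^sub>R h) - norm f) /\<^sub>R t) \<longlongrightarrow> L h) (at 0)"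
    using G_smoothE[OF f] by blast
  have *: "(\<lambda>n. h (\<tau> n)) \<longlonglongrightarrow> L h"
    if \<tau>: "\<And>n. norm (\<tau> n) \<le> 1" "(\<lambda>n. f (\<tau> n)) \<longlonglongrightarrow> 1" for \<tau> :: "nat \<Rightarrow> 'a" and h :: "'a \<Rightarrow>\<^sub>L real"
  proof (rule Gateaux_norm_limit[OF L, where \<phi> = "\<lambda>n h. blinfun_apply h (\<tau> n)"])
    fix n show "linear (\<lambda>h. blinfun_apply h (\<tau> n))"
      by (intro bounded_linear.linear blinfun.bounded_linear_left)
    fix h :: "'a \<Rightarrow>\<^sub>L real"
    show "h (\<tau> n) \<le> norm h"
      using blinfun_le_norm[of h "\<tau> n"] mult_left_le[OF \<tau>(1) norm_ge_zero[of h], of n] by linarith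
  qed (simp_all add: \<tau>(2) blinfun.minus_right)
  \<comment> \<open>The constant sequence at \<open>x\<close> is itself maximising, which identifies
    the bidual element \<open>L\<close> with evaluation at \<open>x\<close>.\<close>
  have "h x = L h" for h :: "'a \<Rightarrow>\<^sub>L real"
    using *[of "\<lambda>n. x" h] x by (simp add: LIMSEQ_const_iff)
  with *[of \<sigma>] \<sigma> show "limitin weak_topology \<sigma> x sequentially"
    by (auto simp: limitin_weak_topology_iff image_subset_iff)
qed

section \<open>Smooth norm-attaining functionals\<close>

text \<open>Baire's theorem for the dense open sets witnessing that \<open>A\<close> is comeager,
  together with open sets whose intersection is \<open>B\<close>; the latter are dense because they
  contain \<open>B\<close>.\<close>

lemma dense_in_comeager_Int_gdelta:
  assumes X: "completely_metrizable_space X" and A: "comeager_in X A"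
    and B: "gdelta_in X B" "dense_in X B"
  shows "dense_in X (A \<inter> B)"
proof -
  obtain \<U> where \<U>: "countable \<U>" "\<And>U. U \<in> \<U> \<Longrightarrow> openin X U \<and> dense_in X U"
    "topspace X \<inter> \<Inter>\<U> \<subseteq> A" and AX: "A \<subseteq> topspace X"
    using A unfolding comeager_in_def by blast
  obtain \<V> where \<V>: "countable \<V>" "\<And>V. V \<in> \<V> \<Longrightarrow> openin X V" "\<Inter>\<V> = B" and BX: "B \<subseteq> topspace X"
    using B(1) unfolding gdelta_in_alt intersection_of_def by blast
  \<comment> \<open>The member \<open>topspace X\<close> keeps the intersection inside the space,
    even when both families are empty.\<close>
  let ?G = "insert (topspace X) (\<U> \<union> \<V>)"
  have "X closure_of \<Inter>?G = topspace X"
  proof (rule Baire_category)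
    fix T assume "T \<in> ?G"
    then consider "T = topspace X" | "T \<in> \<U>" | "T \<in> \<V>" by blast
    then show "openin X T \<and> X closure_of T = topspace X"
    proof cases
      case 3
      then have "B \<subseteq> T" using \<V>(3) by blast
      then have "X closure_of B \<subseteq> X closure_of T" by (rule closure_of_mono)
      then show ?thesis
        using \<V>(2)[OF 3] B(2) closure_of_subset_topspace[of X T] unfolding dense_in_def by auto
    qed (use \<U>(2) in \<open>auto simp: dense_in_def\<close>)
  qed (use X \<U>(1) \<V>(1) in auto)
  moreover have "\<Inter>?G \<subseteq> A \<inter> B" using \<U>(3) \<V>(3) by auto
  then have "X closure_of \<Inter>?G \<subseteq> X closure_of (A \<inter> B)" by (rule closure_of_mono)
  ultimately show ?thesis
    using AX closure_of_subset_topspace[of X "A \<inter> B"] unfolding dense_in_def by auto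
qed

lemma dense_in_openin_Int:
  assumes "dense_in X A" "openin X U" "U \<noteq> {}" shows "A \<inter> U \<noteq> {}"
  using assms dense_intersects_open[of X A] unfolding dense_in_def by blast

text \<open>The dual sphere is closed in a complete space, hence completely metrizable, so Baire's
  theorem applies there.\<close>

lemma dense_in_smooth_norm_attaining:
  assumes "comeager_in (top_of_set (sphere 0 1)) (norm_attaining :: ('a::banach \<Rightarrow>\<^sub>L real) set)"
    and "weakly_Asplund TYPE('a \<Rightarrow>\<^sub>L real)"
  shows "dense_in (top_of_set (sphere 0 1)) {f :: 'a \<Rightarrow>\<^sub>L real. f \<in> norm_attaining \<and> G_smooth f}"
proof -
  have "closed (sphere (0 :: 'a \<Rightarrow>\<^sub>L real) 1)"
    unfolding sphere_def by (intro closed_Collect_eq continuous_intros)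
  then have "completely_metrizable_space (top_of_set (sphere (0 :: 'a \<Rightarrow>\<^sub>L real) 1))"
    using completely_metrizable_space_closedin[OF completely_metrizable_space_euclidean]
    by (metis closed_closedin)
  then have "dense_in (top_of_set (sphere 0 1))
      ((norm_attaining :: ('a \<Rightarrow>\<^sub>L real) set) \<inter> {f. G_smooth f})"
    using assms unfolding weakly_Asplund_def by (intro dense_in_comeager_Int_gdelta) auto
  then show ?thesis by (simp add: Int_def)
qed

section \<open>The two conclusions on exposed points\<close>

lemma norm_attainingE:
  assumes "f \<in> norm_attaining"
  obtains x where "norm f = 1" "norm x = 1" "f x = 1"
  using assms by (auto simp: norm_attaining_def duality_image_def duality_map_def)

lemma not_G_smooth_omega_isolated:
  fixes x :: "'a::banach"
  assumes dim: "dim_at_least TYPE('a) 2"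
    and dense: "dense_in (top_of_set (sphere 0 1)) {f :: 'a \<Rightarrow>\<^sub>L real. f \<in> norm_attaining \<and> G_smooth f}"
    and smooth: "G_smooth x" and iso: "omega_isolated x"
  shows False
proof -
  obtain V where V: "openin weak_topology V" "V \<inter> omega_exp = {x}"
    using iso unfolding omega_isolated_def openin_subtopology by blast
  obtain f where f: "norm f = 1" "omega_exposes f x"
    using iso by (auto simp: omega_isolated_def omega_exp_iff)
  have fx: "f x = 1" using omega_exposes_imp_eq_1 f by blast
  obtain d where d: "d > 0" "\<And>y. norm y \<le> 1 \<Longrightarrow> f y > 1 - d \<Longrightarrow> f y \<le> 1 \<Longrightarrow> y \<in> V"
    using omega_exposes_imp_slice_subset[OF f(2) V(1)] V(2) by blast
  \<comment> \<open>Here dimension at least two enters: it makes the punctured ball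
    \<open>?U\<close> on the dual sphere nonempty.\<close>
  obtain g0 where g0: "norm g0 = 1" "g0 \<noteq> f" "dist g0 f < d"
    using exists_near_on_dual_sphere[OF dim f(1) d(1)] .
  let ?U = "sphere 0 1 \<inter> (ball f d - {f})"
  have "openin (top_of_set (sphere 0 1)) ?U"
    by (intro openin_open_Int open_delete open_ball)
  moreover have "g0 \<in> ?U" using g0 by (simp add: dist_commute)
  ultimately obtain g where g: "g \<in> norm_attaining" "G_smooth g" "g \<in> ?U"
    using dense_in_openin_Int[OF dense, of ?U] by blast
  obtain y where y: "norm g = 1" "norm y = 1" "g y = 1"
    using norm_attainingE[OF g(1)] .
  have "y \<in> omega_exp"
    using G_smooth_attaining_imp_omega_exposes[OF g(2) y(2,3)] y by (auto simp: omega_exp_iff)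
  moreover have "y \<in> V"
  proof (rule d(2))
    \<comment> \<open>The estimate \<open>1 - f y = (g - f) y \<le> norm (g - f) < d\<close> is why
      the ball has the width of the slice as its radius.\<close>
    have "(g - f) y \<le> norm (g - f)" using blinfun_le_norm[of "g - f" y] y by simp
    then show "f y > 1 - d"
      using g(3) y by (simp add: blinfun.diff_left dist_norm norm_minus_commute)
    show "f y \<le> 1" using blinfun_le_norm[of f y] f y by simp
  qed (use y in simp)
  ultimately have "y = x" using V(2) by blast
  then have "g = f" using G_smooth_unique_support[OF smooth] f fx y by blast
  with g(3) show False by blast
qed

lemma dense_in_omega_exp:
  assumes dense: "dense_in (top_of_set (sphere 0 1))
      {f :: 'a::banach \<Rightarrow>\<^sub>L real. f \<in> norm_attaining \<and> G_smooth f}"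
    and star: "condition_star TYPE('a)"
  shows "dense_in (top_of_set (sphere 0 1)) (omega_exp :: 'a set)"
proof -
  let ?S = "top_of_set (sphere (0::'a) 1)"
  have "omega_exp \<inter> U \<noteq> {}" if U: "openin ?S U" "U \<noteq> {}" for U
  proof -
    let ?W = "top_of_set norm_attaining interior_of duality_image U"
    have "?W \<noteq> {}" using star U unfolding condition_star_def by blast
    \<comment> \<open>\<open>?W\<close> is only relatively open in the norm-attaining functionals;
      an open set \<open>T\<close> with this trace carries it to the dual sphere, where density is
      available.\<close>
    moreover obtain T where T: "open T" "?W = norm_attaining \<inter> T"
      using openin_interior_of[of "top_of_set norm_attaining" "duality_image U"]
      unfolding openin_open by blast
    moreover have "(norm_attaining :: ('a \<Rightarrow>\<^sub>L real) set) \<subseteq> sphere 0 1"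
      by (auto elim: norm_attainingE)
    ultimately have "sphere 0 1 \<inter> T \<noteq> {}" by blast
    from dense_in_openin_Int[OF dense openin_open_Int[OF T(1)] this]
    obtain f where f: "f \<in> norm_attaining" "G_smooth f" "f \<in> T" by blast
    then have "f \<in> ?W" unfolding T(2) by simp
    then have "f \<in> duality_image U" by (rule subsetD[OF interior_of_subset])
    then obtain x where x: "x \<in> U" "norm f = 1" "f x = 1"
      by (auto simp: duality_image_def duality_map_def)
    have "norm x = 1" using x(1) openin_subset[OF U(1)] by auto
    then have "x \<in> omega_exp"
      using G_smooth_attaining_imp_omega_exposes[OF f(2)] x by (auto simp: omega_exp_iff)
    with x(1) show ?thesis by blast
  qed
  then have "?S closure_of omega_exp = topspace ?S"
    unfolding dense_intersects_open by (intro allI impI) (elim conjE)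
  moreover have "omega_exp \<subseteq> topspace ?S" by (auto simp: omega_exp_def)
  ultimately show ?thesis unfolding dense_in_def by (intro conjI)
qed

theorem theorem2p8:
  assumes "dim_at_least TYPE('a::banach) 2"
    and "comeager_in (top_of_set (sphere 0 1)) (norm_attaining :: ('a \<Rightarrow>\<^sub>L real) set)"
    and "weakly_Asplund TYPE('a \<Rightarrow>\<^sub>L real)"
  shows "\<not> (\<exists>x::'a. x \<in> sphere 0 1 \<and> G_smooth x \<and> omega_isolated x) \<and>
    (condition_star TYPE('a) \<longrightarrow>
      dense_in (top_of_set (sphere 0 1)) (omega_exp :: 'a set))"
proof (intro conjI impI notI; (elim exE conjE)?)
  note dense = dense_in_smooth_norm_attaining[OF assms(2,3)]
  show False if "G_smooth x" "omega_isolated x" for x :: 'a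
    by (rule not_G_smooth_omega_isolated[OF assms(1) dense that])
  show "dense_in (top_of_set (sphere 0 1)) (omega_exp :: 'a set)" if "condition_star TYPE('a)"
    by (rule dense_in_omega_exp[OF dense that])
qed

end
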